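(* Let $n=q^2+q+1+m(q+1)-t$, where $q$ is a prime power and $m,t$ are integers with $1\le m\le q+1$ and $0\le t\le q$. Then $\mu(n)\le q+m$, where $\mu(n)$ is the $n$th mediation number.
   Context: Digraphs are finite, without loops or parallel arcs (both arcs $xy$ and $yx$ may be present). For a digraph $D$ and a vertex $x$, let $N^-(x)=\{y: yx\in A(D)\}$ and $N^-[x]=\{x\}\cup N^-(x)$; $\Delta^-(D)$ is the maximum of $|N^-(x)|$ over vertices $x$. A digraph $D$ is mediated if for every pair $x,y$ of distinct vertices there is a vertex $z$ (possibly $z=x$ or $z=y$) such that $x,y\in N^-[z]$. For $n\ge 1$, the $n$th mediation number $\mu(n)$ is the minimum of $\Delta^-(D)$ over all mediated digraphs $D$ on $n$ vertices. A prime power is an integer $p^k$ with $p$ prime and $k\ge 1$. *)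

theory Defs
  imports "Graph_Theory.Pair_Digraph" "HOL-Number_Theory.Prime_Powers"
begin

text \<open>Digraphs are \<open>pair_digraph\<close>s: finite, loopless, and without parallel arcs because
  the arcs form a set of ordered pairs. An arc \<open>(y, x)\<close> goes from \<open>y\<close> to \<open>x\<close>.\<close>

definition in_nbhd :: "'a pair_pre_digraph \<Rightarrow> 'a \<Rightarrow> 'a set" where
  "in_nbhd D x = {y. (y, x) \<in> parcs D}"

definition closed_in_nbhd :: "'a pair_pre_digraph \<Rightarrow> 'a \<Rightarrow> 'a set" where
  "closed_in_nbhd D x = insert x (in_nbhd D x)"

definition max_in_degree :: "'a pair_pre_digraph \<Rightarrow> nat" where
  "max_in_degree D = Max ((\<lambda>x. card (in_nbhd D x)) ` pverts D)"

definition mediated :: "'a pair_pre_digraph \<Rightarrow> bool" where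
  "mediated D \<longleftrightarrow> (\<forall>x\<in>pverts D. \<forall>y\<in>pverts D. x \<noteq> y \<longrightarrow>
     (\<exists>z\<in>pverts D. x \<in> closed_in_nbhd D z \<and> y \<in> closed_in_nbhd D z))"

text \<open>Taking the vertices among the natural numbers loses nothing
  (see \<open>mediation_number_le\<close> below). The number is only meaningful for \<open>n \<ge> 1\<close>, where the
  minimum is attained (\<open>mediation_number_attained\<close>).\<close>

definition mediation_number :: "nat \<Rightarrow> nat" where
  "mediation_number n = (LEAST d. \<exists>D :: nat pair_pre_digraph.
     pair_digraph D \<and> card (pverts D) = n \<and> mediated D \<and> max_in_degree D = d)"

lemma in_degree_eq_card_in_nbhd: "in_degree (with_proj D) x = card (in_nbhd D x)"
proof -
  have "bij_betw fst (in_arcs (with_proj D) x) (in_nbhd D x)"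
    by (rule bij_betwI[where g = "\<lambda>y. (y, x)"]) (auto simp: in_nbhd_def)
  then show ?thesis
    by (simp add: in_degree_def bij_betw_same_card)
qed

lemma mediation_number_attained:
  assumes "n \<ge> 1"
  shows "\<exists>D :: nat pair_pre_digraph. pair_digraph D \<and> card (pverts D) = n \<and> mediated D \<and>
    max_in_degree D = mediation_number n"
proof -
  let ?K = "\<lparr>pverts = {..<n}, parcs = {(x, y). x < n \<and> y < n \<and> x \<noteq> y}\<rparr>"
  have "finite (parcs ?K)"
    by (rule finite_subset[of _ "{..<n} \<times> {..<n}"]) auto
  then have "pair_digraph ?K"
    by unfold_locales auto
  moreover have "card (pverts ?K) = n" by simp
  moreover have "mediated ?K"
    by (auto simp: mediated_def closed_in_nbhd_def in_nbhd_def)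
  ultimately have "\<exists>d. \<exists>D :: nat pair_pre_digraph. pair_digraph D \<and> card (pverts D) = n \<and>
      mediated D \<and> max_in_degree D = d"
    by blast
  then show ?thesis
    unfolding mediation_number_def by (rule LeastI_ex)
qed

lemma mediation_number_le:
  fixes D :: "'a pair_pre_digraph"
  assumes "pair_digraph D" "card (pverts D) = n" "mediated D"
  shows "mediation_number n \<le> max_in_degree D"
proof -
  interpret pair_digraph D by fact
  obtain f :: "'a \<Rightarrow> nat" where f: "inj_on f (pverts D)"
    using finite_imp_inj_to_nat_seg[OF pair_finite_verts] by blast
  define E where "E = \<lparr>pverts = f ` pverts D, parcs = map_prod f f ` parcs D\<rparr>"
  have eq: "f x = f y \<longleftrightarrow> x = y" if "x \<in> pverts D" "y \<in> pverts D" for x y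
    using f that by (auto dest: inj_onD)
  have "f x \<noteq> f y" if "(x, y) \<in> parcs D" for x y
    using that eq[of x y] pair_no_loops[of "(x, y)"] in_arcsD1 in_arcsD2 by auto
  then have "pair_digraph E"
    by unfold_locales
      (auto simp: E_def pair_finite_verts pair_finite_arcs
        dest: in_arcsD1 in_arcsD2)
  moreover have "card (pverts E) = n"
    using f assms(2) by (simp add: E_def card_image)
  moreover have nb: "in_nbhd E (f x) = f ` in_nbhd D x" if "x \<in> pverts D" for x
  proof (intro equalityI subsetI)
    fix v assume "v \<in> in_nbhd E (f x)"
    then obtain a b where "(a, b) \<in> parcs D" "v = f a" "f x = f b"
      by (auto simp: in_nbhd_def E_def)
    moreover from this have "x = b" using that by (metis eq in_arcsD2)
    ultimately show "v \<in> f ` in_nbhd D x" by (auto simp: in_nbhd_def)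
  next
    fix v assume "v \<in> f ` in_nbhd D x"
    then show "v \<in> in_nbhd E (f x)" by (force simp: in_nbhd_def E_def)
  qed
  moreover have cnb: "closed_in_nbhd E (f x) = f ` closed_in_nbhd D x" if "x \<in> pverts D" for x
    using nb[OF that] by (simp add: closed_in_nbhd_def)
  moreover have "mediated E"
    unfolding mediated_def
  proof (intro ballI impI)
    fix u v assume "u \<in> pverts E" "v \<in> pverts E" "u \<noteq> v"
    then obtain x y where xy: "x \<in> pverts D" "y \<in> pverts D" "u = f x" "v = f y" "x \<noteq> y"
      by (auto simp: E_def)
    then obtain z where z: "z \<in> pverts D" "x \<in> closed_in_nbhd D z" "y \<in> closed_in_nbhd D z"
      using assms(3) unfolding mediated_def by blast
    have "f z \<in> pverts E" using z(1) by (simp add: E_def)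
    then show "\<exists>w\<in>pverts E. u \<in> closed_in_nbhd E w \<and> v \<in> closed_in_nbhd E w"
      using cnb[OF z(1)] z xy by blast
  qed
  moreover have "max_in_degree E = max_in_degree D"
  proof -
    have "card (in_nbhd E (f x)) = card (in_nbhd D x)" if "x \<in> pverts D" for x
    proof -
      have "in_nbhd D x \<subseteq> pverts D" by (auto simp: in_nbhd_def dest: in_arcsD1)
      then show ?thesis using nb[OF that] f by (metis card_image inj_on_subset)
    qed
    then show ?thesis by (simp add: max_in_degree_def E_def image_image cong: image_cong_simp)
  qed
  ultimately have "\<exists>E :: nat pair_pre_digraph. pair_digraph E \<and> card (pverts E) = n \<and>
      mediated E \<and> max_in_degree E = max_in_degree D"
    by blast
  then show ?thesis
    unfolding mediation_number_def by (rule Least_le)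
qed

end

theory Submission
  imports Defs "HOL-Algebra.Algebraic_Closure" "HOL-Number_Theory.Residues"
begin

text \<open>Take the projective plane over the field with \<open>q\<close> elements and replace every point at
  infinity by \<open>m + 1\<close> copies, dropping one copy for \<open>t\<close> of them. Every other line meets the line at
  infinity once, so it grows by at most \<open>m\<close> points and still covers the pairs it used to cover;
  pairs of copies of the same point are covered by any affine line through that point. Arrange
  the copies in a grid with the copies of a point forming a column. Two copies in different columns
  in rows \<open>r \<le> r'\<close> lie in the union of row \<open>r\<close> and the column of the second copy, and such
  a union has at most \<open>q + 1 + m\<close> elements. All these sets are closed in-neighbourhoods of distinct
  elements they contain.\<close>

section \<open>Finite fields of prime power order\<close>

lemma (in cring) binomial:
  assumes x: "x \<in> carrier R" and y: "y \<in> carrier R"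
  shows "(x \<oplus> y) [^] (n::nat) = (\<Oplus>k\<in>{..n}. [(n choose k)] \<cdot> (x [^] k \<otimes> y [^] (n - k)))"
proof (induction n)
  case 0
  then show ?case by (simp add: x y)
next
  case (Suc n)
  \<comment> \<open>The exponents belong to \<open>Suc n\<close> whatever \<open>N\<close> is; only
    the coefficient depends on \<open>N\<close>. After an index shift, Pascal's rule turns
    coefficients for \<open>n\<close> into those of \<open>f (Suc n)\<close>.\<close>
  define f where "f N k = [(N choose k)] \<cdot> (x [^] k \<otimes> y [^] (Suc n - k))" for N k
  have f_closed [simp]: "f N k \<in> carrier R" for N k
    using x y by (simp add: f_def)
  have a: "[c] \<cdot> (x [^] k \<otimes> y [^] (n - k)) \<otimes> x = [c] \<cdot> (x [^] Suc k \<otimes> y [^] (Suc n - Suc k))"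
    for k c :: nat
    using x y by (subst add_pow_ldistr) (auto simp: m_ac)
  have b: "[(n choose k)] \<cdot> (x [^] k \<otimes> y [^] (n - k)) \<otimes> y = f n k" if "k \<le> n" for k
    using x y that unfolding f_def by (subst add_pow_ldistr) (auto simp: m_ac Suc_diff_le)
  have "(x \<oplus> y) [^] Suc n = (x \<oplus> y) [^] n \<otimes> x \<oplus> (x \<oplus> y) [^] n \<otimes> y"
    using x y by (simp add: r_distr)
  also have "(x \<oplus> y) [^] n \<otimes> x = (\<Oplus>k\<in>{..n}. [(n choose k)] \<cdot> (x [^] Suc k \<otimes> y [^] (Suc n - Suc k)))"
    unfolding Suc.IH using x y by (subst finsum_ldistr) (auto simp: a)
  also have "(x \<oplus> y) [^] n \<otimes> y = (\<Oplus>k\<in>{..n}. f n k)"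
    unfolding Suc.IH using x y by (subst finsum_ldistr) (auto intro!: finsum_cong' simp: b)
  also have "\<dots> = (\<Oplus>k\<in>{..Suc n}. f n k)"
    using x y by (subst finsum_Suc) (auto simp: f_def binomial_eq_0)
  also have "\<dots> = (\<Oplus>k\<in>{..n}. f n (Suc k)) \<oplus> f n 0"
    by (rule finsum_Suc2) simp
  also have "(\<Oplus>k\<in>{..n}. [(n choose k)] \<cdot> (x [^] Suc k \<otimes> y [^] (Suc n - Suc k))) \<oplus> \<dots>
    = (\<Oplus>k\<in>{..n}. [(n choose k)] \<cdot> (x [^] Suc k \<otimes> y [^] (Suc n - Suc k)) \<oplus> f n (Suc k)) \<oplus> f n 0"
    using x y by (subst finsum_addf) (auto simp del: nat_pow_Suc simp: a_assoc)
  also have "\<dots> = (\<Oplus>k\<in>{..n}. f (Suc n) (Suc k)) \<oplus> f (Suc n) 0"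
    using x y by (simp del: nat_pow_Suc add: f_def add.nat_pow_mult)
  also have "\<dots> = (\<Oplus>k\<in>{..Suc n}. f (Suc n) k)"
    by (rule finsum_Suc2[symmetric]) simp
  finally show ?case by (simp add: f_def)
qed

text \<open>The inner binomial coefficients are divisible by \<open>p\<close>, so their terms
  vanish; induction on \<open>k\<close> passes to powers of \<open>p\<close>. Working in a
  commutative ring covers both a field and its polynomial ring.\<close>

lemma (in cring) frobenius_add:
  assumes p: "Factorial_Ring.prime (p::nat)" "[p] \<cdot> \<one> = \<zero>"
    and x: "x \<in> carrier R" and y: "y \<in> carrier R"
  shows "(x \<oplus> y) [^] (p ^ k) = x [^] (p ^ k) \<oplus> y [^] (p ^ k)"
proof (induction k)
  case 0
  then show ?case using x y by simp
next
  case (Suc k)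
  have char: "[c] \<cdot> z = \<zero>" if c: "p dvd c" "z \<in> carrier R" for c :: nat and z
  proof -
    obtain d where d: "c = p * d" using c(1) by (elim dvdE)
    have "[c] \<cdot> z = [c] \<cdot> \<one> \<otimes> z" using c by (simp add: add_pow_ldistr)
    also have "[c] \<cdot> \<one> = \<zero>"
      using p(2) by (simp add: d add.nat_pow_pow[symmetric])
    finally show ?thesis using c by simp
  qed
  have *: "(u \<oplus> v) [^] p = u [^] p \<oplus> v [^] p" if u: "u \<in> carrier R" and v: "v \<in> carrier R" for u v
  proof -
    obtain m where m: "p = Suc m" using p(1) by (metis not_prime_0 not0_implies_Suc)
    define g where "g k = [(p choose k)] \<cdot> (u [^] k \<otimes> v [^] (p - k))" for k
    have g [simp]: "g k \<in> carrier R" for k using u v by (simp add: g_def)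
    have z: "g k = \<zero>" if "0 < k" "k < p" for k
      unfolding g_def using that u v p(1) by (intro char dvd_choose_prime) auto
    \<comment> \<open>With \<open>p = m' + 2\<close> the terms for \<open>k = p\<close> and
      \<open>k = 0\<close> can be split off at the two ends, leaving only vanishing ones.\<close>
    obtain m' where m': "m = Suc m'" using p(1) m by (metis not_prime_1 One_nat_def not0_implies_Suc)
    have "(u \<oplus> v) [^] p = (\<Oplus>k\<in>{..Suc m}. g k)"
      unfolding g_def m[symmetric] by (rule binomial[OF u v])
    also have "\<dots> = g p \<oplus> ((\<Oplus>k\<in>{..m'}. g (Suc k)) \<oplus> g 0)"
      unfolding m' by (subst finsum_Suc, simp, subst finsum_Suc2) (simp_all add: m m')
    also have "(\<Oplus>k\<in>{..m'}. g (Suc k)) = \<zero>"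
      by (rule add.finprod_one_eqI) (simp add: z m m')
    finally show ?thesis using u v by (simp add: g_def)
  qed
  show ?case
    using x y Suc.IH * by (simp add: nat_pow_pow[symmetric] mult.commute[of p])
qed

text \<open>Multiples of one are constant polynomials, and \<open>normalize\<close> turns the
  constant zero into the empty list, the zero polynomial. This makes \<open>frobenius_add\<close>
  applicable to polynomials.\<close>

lemma (in domain) char_poly_ring:
  assumes "[(n::nat)] \<cdot> \<one> = \<zero>"
  shows "[n] \<cdot>\<^bsub>poly_ring R\<^esub> \<one>\<^bsub>poly_ring R\<^esub> = \<zero>\<^bsub>poly_ring R\<^esub>"
proof -
  interpret UP: domain "poly_ring R"
    by (rule univ_poly_is_domain[OF carrier_is_subring])
  have "[k] \<cdot>\<^bsub>poly_ring R\<^esub> \<one>\<^bsub>poly_ring R\<^esub> = normalize [[k] \<cdot> \<one>]" for k :: nat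
  proof (induction k)
    case 0
    then show ?case by (simp add: univ_poly_zero)
  next
    case (Suc k)
    then show ?case
      by (simp add: univ_poly_one univ_poly_add)
  qed
  with assms show ?thesis by (simp add: univ_poly_zero)
qed

text \<open>In terms of \<open>Y = X - a\<close> and \<open>q = p\<^sup>k\<close> the polynomial is \<open>Y\<^sup>q - Y\<close>, which is not divisible by \<open>Y\<^sup>2\<close>.\<close>

lemma (in field) alg_mult_frobenius_poly_le_1:
  assumes p: "Factorial_Ring.prime (p::nat)" "[p] \<cdot> \<one> = \<zero>" and k: "k > 0"
    and a: "a \<in> carrier R" "a [^] (p ^ k) = a"
  shows "alg_mult (X [^]\<^bsub>poly_ring R\<^esub> (p ^ k) \<ominus>\<^bsub>poly_ring R\<^esub> X) a \<le> 1"
proof (rule ccontr)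
  define q where "q = p ^ k"
  obtain r where r: "q = Suc (Suc r)"
    using one_less_power[OF prime_gt_1_nat[OF p(1)] k] that[of "q - 2"] by (simp add: q_def)
  interpret UP: domain "poly_ring R"
    by (rule univ_poly_is_domain[OF carrier_is_subring])
  interpret E: ring_hom_ring "poly_ring R" R "\<lambda>p. eval p a"
    by (rule eval_ring_hom[OF carrier_is_subring a(1)])
  have "ring_hom_ring R (poly_ring R) poly_of_const"
    using canonical_embedding_ring_hom[OF carrier_is_subring] by simp
  then interpret C: ring_hom_ring R "poly_ring R" poly_of_const .
  let ?P = "X [^]\<^bsub>poly_ring R\<^esub> q \<ominus>\<^bsub>poly_ring R\<^esub> X"
  let ?A = "poly_of_const a"
  define Y where "Y = X \<ominus>\<^bsub>poly_ring R\<^esub> ?A"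
  have X: "X \<in> carrier (poly_ring R)"
    by (rule var_closed[OF carrier_is_subring])
  have A: "?A \<in> carrier (poly_ring R)" using a by simp
  have Y: "Y \<in> carrier (poly_ring R)" using X A by (simp add: Y_def)
  have Y_list: "Y = [\<one>, \<ominus> a]"
  proof -
    have "Y = poly_add [\<one>, \<zero>] (poly_of_const (\<ominus> a))"
      unfolding Y_def UP.minus_eq C.hom_a_inv[OF a(1), symmetric] univ_poly_add var_def ..
    then show ?thesis using a by (simp add: poly_of_const_def)
  qed
  have X_eq: "X = Y \<oplus>\<^bsub>poly_ring R\<^esub> ?A"
    using X A by (simp add: Y_def UP.minus_eq UP.a_assoc UP.l_neg)
  have "X [^]\<^bsub>poly_ring R\<^esub> q = Y [^]\<^bsub>poly_ring R\<^esub> q \<oplus>\<^bsub>poly_ring R\<^esub> ?A [^]\<^bsub>poly_ring R\<^esub> q"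
    unfolding q_def X_eq by (rule UP.frobenius_add[OF p(1) char_poly_ring[OF p(2)] Y A])
  also have "?A [^]\<^bsub>poly_ring R\<^esub> q = ?A"
    using C.hom_nat_pow[OF a(1), of q] a(2) unfolding q_def by argo
  finally have *: "X [^]\<^bsub>poly_ring R\<^esub> q = Y [^]\<^bsub>poly_ring R\<^esub> q \<oplus>\<^bsub>poly_ring R\<^esub> ?A" .
  have P: "?P = Y [^]\<^bsub>poly_ring R\<^esub> q \<ominus>\<^bsub>poly_ring R\<^esub> Y"
  proof -
    have "\<ominus>\<^bsub>poly_ring R\<^esub> Y = ?A \<oplus>\<^bsub>poly_ring R\<^esub> \<ominus>\<^bsub>poly_ring R\<^esub> X"
      using X A by (simp add: Y_def UP.minus_eq UP.minus_add UP.a_comm)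
    with * show ?thesis
      using X Y A by (simp add: UP.minus_eq UP.a_assoc)
  qed
  assume "\<not> alg_mult (X [^]\<^bsub>poly_ring R\<^esub> (p ^ k) \<ominus>\<^bsub>poly_ring R\<^esub> X) a \<le> 1"
  then have "2 \<le> alg_mult ?P a" by (simp add: q_def)
  then have "(Y [^]\<^bsub>poly_ring R\<^esub> (2::nat)) pdivides ?P"
    unfolding Y_list using X a by (intro le_alg_mult_imp_pdivides) auto
  then obtain Q where Q: "Q \<in> carrier (poly_ring R)" "?P = Y [^]\<^bsub>poly_ring R\<^esub> (2::nat) \<otimes>\<^bsub>poly_ring R\<^esub> Q"
    unfolding pdivides_def factor_def by blast
  let ?Z = "Y [^]\<^bsub>poly_ring R\<^esub> r"
  have Z: "?Z \<in> carrier (poly_ring R)" using Y by simp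
  \<comment> \<open>Cancelling \<open>Y\<close> in \<open>Y^q - Y = Y^2 Q\<close> leaves
    \<open>Y^(q-1) - 1 = Y Q\<close>; evaluation at \<open>a\<close>, where \<open>Y\<close>
    vanishes, gives \<open>-1 = 0\<close>.\<close>
  have "Y \<otimes>\<^bsub>poly_ring R\<^esub> (?Z \<otimes>\<^bsub>poly_ring R\<^esub> Y \<ominus>\<^bsub>poly_ring R\<^esub> \<one>\<^bsub>poly_ring R\<^esub>)
      = Y [^]\<^bsub>poly_ring R\<^esub> q \<ominus>\<^bsub>poly_ring R\<^esub> Y"
    using Y Z UP.m_comm[of Y "?Z \<otimes>\<^bsub>poly_ring R\<^esub> Y"] unfolding r
    by (simp add: UP.minus_eq UP.r_distr UP.r_minus)
  also have "\<dots> = Y \<otimes>\<^bsub>poly_ring R\<^esub> (Y \<otimes>\<^bsub>poly_ring R\<^esub> Q)"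
    using P Q Y by (simp add: numeral_2_eq_2 UP.m_assoc)
  finally have "?Z \<otimes>\<^bsub>poly_ring R\<^esub> Y \<ominus>\<^bsub>poly_ring R\<^esub> \<one>\<^bsub>poly_ring R\<^esub> = Y \<otimes>\<^bsub>poly_ring R\<^esub> Q"
    using Y Z Q by (subst (asm) UP.m_lcancel) (auto simp: Y_list univ_poly_zero)
  then have "eval (?Z \<otimes>\<^bsub>poly_ring R\<^esub> Y \<ominus>\<^bsub>poly_ring R\<^esub> \<one>\<^bsub>poly_ring R\<^esub>) a = eval (Y \<otimes>\<^bsub>poly_ring R\<^esub> Q) a"
    by simp
  moreover have "eval Y a = \<zero>"
    using a by (simp add: Y_list r_neg)
  moreover have "eval ?Z a \<in> carrier R" "eval Q a \<in> carrier R"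
    using Z Q(1) by simp_all
  ultimately have "\<ominus> \<one> = \<zero>"
    using Y Z Q(1) by (simp add: UP.minus_eq)
  then show False
    by (metis a_inv_def add.inv_eq_1_iff one_closed one_not_zero)
qed

text \<open>In an algebraic closure of the prime field, the solutions of \<open>a^q = a\<close> form
  a subfield and are exactly the roots of \<open>X^q - X\<close>, all of them simple. The type of
  \<open>F\<close> is that of the algebraic closure of a ring on the integers.\<close>

lemma exists_field_of_primepow_order:
  assumes "primepow q"
  shows "\<exists>F :: ((int list \<times> nat) multiset \<Rightarrow> int) ring. field F \<and> order F = q"
proof -
  from assms obtain p k where p: "Factorial_Ring.prime p" and k: "k > 0" and q: "q = p ^ k"
    by (auto simp: primepow_def)
  define R where "R = residue_ring (int p)"
  interpret R: residues_prime p R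
    by (unfold_locales) (use p in \<open>auto simp: R_def\<close>)
  interpret R: field R by (rule R.is_field)
  define L where "L = R.alg_closure"
  interpret L: algebraic_closure L "R.indexed_const ` carrier R"
    unfolding L_def by (rule R.alg_closureE)
  interpret h: ring_hom_ring R L R.indexed_const
    using R.alg_closureE(2) by (intro ring_hom_ringI2) (auto simp: L_def[symmetric] R.ring_axioms L.ring_axioms)
  have "[n] \<cdot>\<^bsub>R\<^esub> \<one>\<^bsub>R\<^esub> = int n mod int p" for n :: nat
    by (induction n) (auto simp: R.res_add_eq R.res_zero_eq R.res_one_eq mod_simps add.commute)
  then have "[p] \<cdot>\<^bsub>R\<^esub> \<one>\<^bsub>R\<^esub> = \<zero>\<^bsub>R\<^esub>" by (simp add: R.res_zero_eq)
  moreover have "R.indexed_const ([n] \<cdot>\<^bsub>R\<^esub> \<one>\<^bsub>R\<^esub>) = [n] \<cdot>\<^bsub>L\<^esub> \<one>\<^bsub>L\<^esub>" for n :: nat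
    by (induction n) auto
  ultimately have char: "[p] \<cdot>\<^bsub>L\<^esub> \<one>\<^bsub>L\<^esub> = \<zero>\<^bsub>L\<^esub>"
    by (metis h.hom_zero)
  have q1: "q > 1" unfolding q by (rule one_less_power[OF prime_gt_1_nat[OF p] k])
  define K where "K = {a \<in> carrier L. a [^]\<^bsub>L\<^esub> q = a}"
  \<comment> \<open>Expanding \<open>0 = (a - a)^q\<close> additively avoids a case distinction on
    the parity of \<open>q\<close>.\<close>
  have K_neg: "\<ominus>\<^bsub>L\<^esub> a \<in> K" if "a \<in> K" for a
  proof -
    have a: "a \<in> carrier L" "a [^]\<^bsub>L\<^esub> q = a" using that by (auto simp: K_def)
    have "\<zero>\<^bsub>L\<^esub> = (a \<oplus>\<^bsub>L\<^esub> \<ominus>\<^bsub>L\<^esub> a) [^]\<^bsub>L\<^esub> q"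
      using a q1 by (simp add: L.r_neg L.nat_pow_zero)
    also have "\<dots> = a \<oplus>\<^bsub>L\<^esub> (\<ominus>\<^bsub>L\<^esub> a) [^]\<^bsub>L\<^esub> q"
      using L.frobenius_add[OF p char, of a "\<ominus>\<^bsub>L\<^esub> a" k] a by (simp add: q)
    finally have "\<ominus>\<^bsub>L\<^esub> a = (\<ominus>\<^bsub>L\<^esub> a) [^]\<^bsub>L\<^esub> q"
      using a by (metis L.a_inv_closed L.add.m_comm L.minus_equality L.nat_pow_closed)
    with a show ?thesis by (simp add: K_def)
  qed
  have "subring K L"
    by (rule L.subringI[OF _ _ K_neg])
       (auto simp: K_def L.nat_pow_distrib L.frobenius_add[OF p char, of _ _ k, folded q])
  moreover have "inv\<^bsub>L\<^esub> a \<in> K" if "a \<in> K - {\<zero>\<^bsub>L\<^esub>}" for a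
  proof -
    have a: "a \<in> Units L" "a [^]\<^bsub>L\<^esub> q = a" using that by (auto simp: K_def L.field_Units)
    have "inv\<^bsub>L\<^esub> a [^]\<^bsub>L\<^esub> q = inv\<^bsub>L\<^esub> a"
    proof (rule L.comm_inv_char[symmetric])
      show "a \<otimes>\<^bsub>L\<^esub> inv\<^bsub>L\<^esub> a [^]\<^bsub>L\<^esub> q = \<one>\<^bsub>L\<^esub>"
        using a L.nat_pow_distrib[of a "inv\<^bsub>L\<^esub> a" q] by (simp add: L.Units_closed)
    qed (use a L.Units_closed in auto)
    with a show ?thesis by (simp add: K_def)
  qed
  ultimately have F: "field (L\<lparr>carrier := K\<rparr>)"
    by (intro L.subfield_iff(2) L.subfieldI')
  define P where "P = X\<^bsub>L\<^esub> [^]\<^bsub>poly_ring L\<^esub> q \<ominus>\<^bsub>poly_ring L\<^esub> X\<^bsub>L\<^esub>"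
  interpret UP: domain "poly_ring L"
    by (rule L.univ_poly_is_domain[OF L.carrier_is_subring])
  have X: "X\<^bsub>L\<^esub> \<in> carrier (poly_ring L)"
    by (rule L.var_closed[OF L.carrier_is_subring])
  then have P: "P \<in> carrier (poly_ring L)" by (simp add: P_def)
  have dX: "degree X\<^bsub>L\<^esub> = 1" by (simp add: var_def)
  have deg: "degree P = q"
  proof -
    have "degree (X\<^bsub>L\<^esub> [^]\<^bsub>poly_ring L\<^esub> q) = q"
      using L.polynomial_pow_degree[OF X, of q] dX by simp
    moreover have "degree (\<ominus>\<^bsub>poly_ring L\<^esub> X\<^bsub>L\<^esub>) = 1"
      using L.univ_poly_a_inv_degree[OF L.carrier_is_subring X] dX by simp
    moreover have "polynomial\<^bsub>L\<^esub> (carrier L) (X\<^bsub>L\<^esub> [^]\<^bsub>poly_ring L\<^esub> q)"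
      "polynomial\<^bsub>L\<^esub> (carrier L) (\<ominus>\<^bsub>poly_ring L\<^esub> X\<^bsub>L\<^esub>)"
      using X by (simp_all add: univ_poly_carrier)
    ultimately show ?thesis
      using q1 L.poly_add_degree_eq[OF L.carrier_is_subring] 
      by (simp add: P_def UP.minus_eq univ_poly_add)
  qed
  have root: "L.is_root P a \<longleftrightarrow> a \<in> K" for a
  proof (cases "a \<in> carrier L")
    case True
    interpret E: ring_hom_ring "poly_ring L" L "\<lambda>p. L.eval p a"
      by (rule L.eval_ring_hom[OF L.carrier_is_subring True])
    have "L.eval P a = a [^]\<^bsub>L\<^esub> q \<ominus>\<^bsub>L\<^esub> a"
      using X True by (simp add: P_def UP.minus_eq L.minus_eq E.hom_nat_pow L.eval_var)
    moreover have "P \<noteq> []" using deg q1 by auto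
    ultimately show ?thesis using True by (simp add: L.is_root_def K_def)
  qed (simp add: L.is_root_def K_def)
  \<comment> \<open>Each element of \<open>K\<close> occurs once in the multiset of roots, so the
    size of that multiset is \<open>card K\<close>. The polynomial splits, so the size is also its
    degree \<open>q\<close>.\<close>
  have "set_mset (L.roots P) = K"
    using L.roots_mem_iff_is_root[OF P] root by auto
  moreover have "count (L.roots P) a = 1" if "a \<in> K" for a
  proof -
    have "a \<in># L.roots P" using that L.roots_mem_iff_is_root[OF P] root by simp
    moreover have "L.alg_mult P a \<le> 1"
      using L.alg_mult_frobenius_poly_le_1[OF p char k, of a] that by (simp add: P_def q K_def)
    ultimately show ?thesis
      using L.alg_mult_eq_count_roots[OF P] by (simp add: le_Suc_eq count_eq_zero_iff)
  qed
  ultimately have "size (L.roots P) = card K"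
    by (simp add: size_multiset_overloaded_eq)
  moreover have "size (L.roots P) = q"
    using L.roots_over_carrier[OF P] deg by (simp add: L.splitted_def)
  ultimately have "order (L\<lparr>carrier := K\<rparr>) = q" by (simp add: order_def)
  with F show ?thesis by blast
qed

section \<open>The digraph of a blown-up projective plane\<close>

text \<open>The in-neighbourhood of \<open>z\<close> is taken to be \<open>N z\<close> without
  \<open>z\<close>; removing \<open>z\<close> accounts for the step from \<open>Suc d\<close> to
  \<open>d\<close>.\<close>

lemma mediation_number_le_of_cover:
  fixes V :: "'a set" and N :: "'a \<Rightarrow> 'a set"
  assumes "finite V" "V \<noteq> {}"
    and N: "\<And>z. z \<in> V \<Longrightarrow> z \<in> N z" "\<And>z. z \<in> V \<Longrightarrow> N z \<subseteq> V" "\<And>z. z \<in> V \<Longrightarrow> card (N z) \<le> Suc d"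
    and cover: "\<And>x y. x \<in> V \<Longrightarrow> y \<in> V \<Longrightarrow> x \<noteq> y \<Longrightarrow> \<exists>z\<in>V. x \<in> N z \<and> y \<in> N z"
  shows "mediation_number (card V) \<le> d"
proof -
  define D where "D = \<lparr>pverts = V, parcs = {(y, x). x \<in> V \<and> y \<in> N x \<and> y \<noteq> x}\<rparr>"
  have N_V: "y \<in> V" if "x \<in> V" "y \<in> N x" for x y
    using N(2) that by blast
  have "finite (parcs D)"
    by (rule finite_subset[of _ "V \<times> V"]) (use assms(1) N_V in \<open>auto simp: D_def\<close>)
  then have D: "pair_digraph D"
    by unfold_locales (use assms(1) N_V in \<open>auto simp: D_def\<close>)
  have closed: "closed_in_nbhd D x = N x" and nbhd: "in_nbhd D x = N x - {x}" if "x \<in> V" for x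
    using N(1)[OF that] that by (auto simp: closed_in_nbhd_def in_nbhd_def D_def)
  have "mediated D"
    using cover closed by (simp add: mediated_def D_def)
  have "card (in_nbhd D x) \<le> d" if "x \<in> V" for x
    using N(1,3)[OF that] that by (simp add: nbhd)
  then have "max_in_degree D \<le> d"
    using assms(1,2) by (auto simp: max_in_degree_def D_def)
  moreover have "mediation_number (card V) \<le> max_in_degree D"
    by (rule mediation_number_le[OF D _ \<open>mediated D\<close>]) (simp add: D_def)
  ultimately show ?thesis by simp
qed

text \<open>The left summand holds the affine points. \<open>Inr (r, c)\<close> is the \<open>r\<close>-th copy of the point at
  infinity with slope \<open>c\<close>, where \<open>None\<close> is the vertical direction; copy \<open>m\<close> is dropped for the
  slopes in \<open>T\<close>.\<close>

type_synonym 'a point = "('a \<times> 'a) + (nat \<times> 'a option)"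

text \<open>The condition \<open>m > 0\<close> keeps at least one copy for every slope. As
  \<open>T\<close> holds finite slopes only, the vertical column stays complete and meets every
  row.\<close>

locale blown_up_plane = field R for R (structure) +
  fixes m :: nat and T :: "'a set"
  assumes finite_carrier: "finite (carrier R)" and m_pos: "m > 0" and T_subset: "T \<subseteq> carrier R"
begin

definition slopes :: "'a option set" where
  "slopes = insert None (Some ` carrier R)"

definition copies :: "(nat \<times> 'a option) set" where
  "copies = {..m} \<times> slopes - {m} \<times> Some ` T"

definition points :: "'a point set" where
  "points = Inl ` (carrier R \<times> carrier R) \<union> Inr ` copies"

definition column :: "'a option \<Rightarrow> 'a point set" where
  "column c = {Inr (r, c) |r. (r, c) \<in> copies}"

definition row :: "nat \<Rightarrow> 'a point set" where
  "row r = {Inr (r, c) |c. (r, c) \<in> copies}"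

definition line :: "'a \<Rightarrow> 'a \<Rightarrow> 'a point set" where
  "line s b = (\<lambda>u. Inl (u, s \<otimes> u \<oplus> b)) ` carrier R"

definition vertical :: "'a \<Rightarrow> 'a point set" where
  "vertical x = (\<lambda>y. Inl (x, y)) ` carrier R"

definition last_copy :: "'a option \<Rightarrow> nat" where
  "last_copy c = (if c \<in> Some ` T then m - 1 else m)"

text \<open>Since \<open>(s, b) \<mapsto> (s, s\<^sup>2 + b)\<close> is a bijection from the non-vertical lines to the affine points,
  each such line is represented by a point on it. The points on the axis \<open>y = 0\<close> are needed for the
  vertical lines, so the lines with \<open>b = - s\<^sup>2\<close> are represented by the last copy of their slope.\<close>

fun nbhd :: "'a point \<Rightarrow> 'a point set" where
  "nbhd (Inl (x, y)) =
    (if y = \<zero> then vertical x \<union> column None else line x (y \<ominus> x \<otimes> x) \<union> column (Some x))"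
| "nbhd (Inr (r, c)) =
    (if r = last_copy c
     then (case c of None \<Rightarrow> row m | Some s \<Rightarrow> line s (\<ominus> (s \<otimes> s)) \<union> column (Some s))
     else row r \<union> column c)"

section \<open>Sizes of the point set and of the neighbourhoods\<close>

lemma card_slopes: "card slopes = Suc (card (carrier R))"
  using finite_carrier by (simp add: slopes_def card_image)

lemma finite_slopes: "finite slopes"
  using finite_carrier by (simp add: slopes_def)

lemma finite_copies: "finite copies"
  using finite_slopes by (simp add: copies_def)

lemma finite_points: "finite points"
  using finite_carrier finite_copies by (simp add: points_def)

text \<open>For a field of order \<open>q\<close> the right side equals
  \<open>q^2 + q + 1 + m(q + 1)\<close>, so \<open>card T = t\<close> yields \<open>n\<close>
  points. Keeping \<open>card T\<close> on the left avoids truncated subtraction.\<close>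

lemma card_points:
  "card points + card T = card (carrier R) ^ 2 + Suc m * Suc (card (carrier R))"
proof -
  have "{m} \<times> Some ` T \<subseteq> {..m} \<times> slopes"
    using T_subset by (auto simp: slopes_def)
  moreover have "finite T" by (rule finite_subset[OF T_subset finite_carrier])
  ultimately have "card copies = Suc m * Suc (card (carrier R)) - card T"
    unfolding copies_def
    by (subst card_Diff_subset) (auto simp: card_cartesian_product card_slopes card_image)
  moreover have "card T \<le> Suc m * Suc (card (carrier R))"
    using card_mono[OF finite_carrier T_subset] by simp
  moreover have "card points = card (carrier R \<times> carrier R) + card copies"
    using finite_carrier finite_copies unfolding points_def
    by (subst card_Un_disjoint) (auto simp: card_image)
  ultimately show ?thesis
    by (simp add: card_cartesian_product power2_eq_square)
qed

lemma last_copy_in_copies: "c \<in> slopes \<Longrightarrow> (last_copy c, c) \<in> copies"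
  using m_pos by (auto simp: last_copy_def copies_def)

lemma line_closed: "s \<in> carrier R \<Longrightarrow> b \<in> carrier R \<Longrightarrow> line s b \<subseteq> points"
  by (auto simp: line_def points_def)

lemma vertical_closed: "x \<in> carrier R \<Longrightarrow> vertical x \<subseteq> points"
  by (auto simp: vertical_def points_def)

lemma column_closed: "column c \<subseteq> points"
  by (auto simp: column_def points_def)

lemma row_closed: "row r \<subseteq> points"
  by (auto simp: row_def points_def)

lemma nbhd_closed:
  assumes "z \<in> points"
  shows "nbhd z \<subseteq> points"
proof (cases z rule: nbhd.cases)
  case (1 x y)
  with assms have "x \<in> carrier R" "y \<in> carrier R" by (auto simp: points_def)
  with 1 show ?thesis by (simp add: line_closed vertical_closed column_closed)
next
  case (2 r c)
  with assms have "c \<in> slopes" by (auto simp: points_def copies_def)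
  then have "line s (\<ominus> (s \<otimes> s)) \<subseteq> points" if "c = Some s" for s
    using that by (intro line_closed) (auto simp: slopes_def)
  with 2 show ?thesis
    by (simp add: row_closed column_closed split: option.split)
qed

lemma mem_nbhd: "z \<in> points \<Longrightarrow> z \<in> nbhd z"
proof (cases z rule: nbhd.cases)
  case (1 x y)
  assume "z \<in> points"
  with 1 have xy: "x \<in> carrier R" "y \<in> carrier R" by (auto simp: points_def)
  \<comment> \<open>The line of slope \<open>x\<close> and intercept \<open>y - x^2\<close> has
    height \<open>y\<close> at abscissa \<open>x\<close>.\<close>
  then have "y = x \<otimes> x \<oplus> (y \<ominus> x \<otimes> x)"
    by (simp add: minus_eq a_lcomm[of "x \<otimes> x"] r_neg)
  with 1 xy show ?thesis by (auto simp: line_def vertical_def)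
next
  case (2 r c)
  assume "z \<in> points"
  with 2 show ?thesis
    by (auto simp: points_def row_def column_def last_copy_def split: option.splits)
qed

lemma card_line: "card (line s b) \<le> card (carrier R)"
  unfolding line_def by (rule card_image_le[OF finite_carrier])

lemma card_vertical: "card (vertical x) \<le> card (carrier R)"
  unfolding vertical_def by (rule card_image_le[OF finite_carrier])

lemma card_column: "card (column c) \<le> Suc m"
proof -
  have "column c \<subseteq> (\<lambda>r. Inr (r, c)) ` {..m}"
    by (auto simp: column_def copies_def)
  from surj_card_le[OF _ this] show ?thesis by simp
qed

lemma card_row: "card (row r) \<le> Suc (card (carrier R))"
proof -
  have "row r \<subseteq> (\<lambda>c. Inr (r, c)) ` slopes"
    by (auto simp: row_def copies_def)
  from surj_card_le[OF finite_slopes this] show ?thesis by (simp add: card_slopes)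
qed

text \<open>The bounds \<open>q + 1\<close> and \<open>m + 1\<close> add up to one too many, but the
  row and the column share the copy \<open>(r, c)\<close>.\<close>

lemma card_row_Un_column:
  assumes "(r, c) \<in> copies"
  shows "card (row r \<union> column c) \<le> Suc (card (carrier R) + m)"
proof -
  have "finite (row r)" "finite (column c)"
    using finite_subset[OF row_closed finite_points] finite_subset[OF column_closed finite_points] by auto
  moreover have "Inr (r, c) \<in> row r \<inter> column c"
    using assms by (simp add: row_def column_def)
  ultimately have "card (row r \<inter> column c) > 0"
    by (auto simp: card_gt_0_iff)
  with card_Un_Int[OF \<open>finite (row r)\<close> \<open>finite (column c)\<close>] card_row[of r] card_column[of c]
  show ?thesis by simp
qed

lemma card_nbhd:
  assumes "z \<in> points"
  shows "card (nbhd z) \<le> Suc (card (carrier R) + m)"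
proof -
  have line: "card (line s b \<union> column c) \<le> Suc (card (carrier R) + m)" for s b c
    using card_Un_le[of "line s b" "column c"] card_column[of c] card_line[of s b] by linarith
  have vertical: "card (vertical x \<union> column c) \<le> Suc (card (carrier R) + m)" for x c
    using card_Un_le[of "vertical x" "column c"] card_column[of c] card_vertical[of x] by linarith
  show ?thesis
  proof (cases z rule: nbhd.cases)
    case (1 x y)
    then show ?thesis using line vertical by simp
  next
    case (2 r c)
    with assms have "(r, c) \<in> copies" by (auto simp: points_def)
    then show ?thesis
      using 2 line card_row_Un_column[of r c] card_row[of m] by (auto split: option.splits)
  qed
qed

section \<open>Covering all pairs of points\<close>

lemma vertical_covered:
  assumes "x \<in> carrier R"
  obtains z where "z \<in> points" "nbhd z = vertical x \<union> column None"
  using assms that[of "Inl (x, \<zero>)"] by (auto simp: points_def)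

lemma line_covered:
  assumes s: "s \<in> carrier R" and b: "b \<in> carrier R"
  obtains z where "z \<in> points" "nbhd z = line s b \<union> column (Some s)"
\<comment> \<open>The representing point \<open>(s, s^2 + b)\<close> may fall on the axis reserved
  for the vertical lines; the last copy of slope \<open>s\<close> then takes its place.\<close>
proof (cases "s \<otimes> s \<oplus> b = \<zero>")
  case True
  then have "b = \<ominus> (s \<otimes> s)"
    using s b by (metis a_comm m_closed minus_equality)
  then show ?thesis
    using s that[of "Inr (last_copy (Some s), Some s)"] last_copy_in_copies[of "Some s"]
    by (auto simp: points_def slopes_def)
next
  case False
  moreover have "s \<otimes> s \<oplus> b \<ominus> s \<otimes> s = b"
    using s b by (simp add: minus_eq a_comm[of "s \<otimes> s" b] a_assoc r_neg)
  ultimately show ?thesis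
    using s b that[of "Inl (s, s \<otimes> s \<oplus> b)"] by (auto simp: points_def)
qed

text \<open>Every affine line of slope \<open>c\<close> comes with the whole column; the proof takes
  the one through the origin.\<close>

lemma column_covered:
  assumes "c \<in> slopes"
  obtains z where "z \<in> points" "column c \<subseteq> nbhd z"
proof (cases c)
  case None
  then show ?thesis using vertical_covered[OF zero_closed] that by (metis Un_upper2)
next
  case (Some s)
  with assms have "s \<in> carrier R" by (auto simp: slopes_def)
  with Some show ?thesis using line_covered[OF _ zero_closed] that by (metis Un_upper2)
qed

lemma mem_line:
  assumes "s \<in> carrier R" "x \<in> carrier R" "y \<in> carrier R"
  shows "Inl (x, y) \<in> line s (y \<ominus> s \<otimes> x)"
proof -
  have "y = s \<otimes> x \<oplus> (y \<ominus> s \<otimes> x)"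
    using assms by (simp add: minus_eq a_lcomm[of "s \<otimes> x"] r_neg)
  then show ?thesis using assms by (auto simp: line_def)
qed

lemma affine_pair_covered:
  assumes xy: "x \<in> carrier R" "y \<in> carrier R" "x' \<in> carrier R" "y' \<in> carrier R"
  shows "\<exists>z\<in>points. Inl (x, y) \<in> nbhd z \<and> Inl (x', y') \<in> nbhd z"
proof (cases "x = x'")
  case True
  obtain z where "z \<in> points" "nbhd z = vertical x \<union> column None"
    using vertical_covered xy(1) .
  with True xy show ?thesis by (auto simp: vertical_def)
next
  case False
  \<comment> \<open>The slope of the joining line. The two points then have the same intercept for
    this slope, which puts both on one line.\<close>
  define s where "s = (y \<ominus> y') \<otimes> inv (x \<ominus> x')"
  have d: "x \<ominus> x' \<in> Units R"
    using False xy by (auto simp: field_Units)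
  have s: "s \<in> carrier R" using d xy by (simp add: s_def)
  have "s \<otimes> (x \<ominus> x') = y \<ominus> y'"
    using d xy by (simp add: s_def m_assoc)
  then have eq: "s \<otimes> x \<ominus> s \<otimes> x' = y \<ominus> y'"
    using s xy by (simp add: minus_eq r_distr r_minus)
  have "y \<ominus> s \<otimes> x = y' \<ominus> s \<otimes> x'"
  proof -
    have "y' \<ominus> s \<otimes> x' = (y' \<ominus> s \<otimes> x) \<oplus> (s \<otimes> x \<ominus> s \<otimes> x')"
      using s xy by algebra
    also have "\<dots> = y \<ominus> s \<otimes> x"
      unfolding eq using s xy by algebra
    finally show ?thesis ..
  qed
  moreover obtain z where "z \<in> points" "nbhd z = line s (y \<ominus> s \<otimes> x) \<union> column (Some s)"
    using line_covered[OF s] s xy by (metis m_closed minus_closed)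
  ultimately show ?thesis
    using mem_line[OF s xy(1,2)] mem_line[OF s xy(3,4)] by auto
qed

text \<open>The line through the affine point in direction \<open>c\<close> comes with all copies
  for \<open>c\<close>.\<close>

lemma affine_infinite_pair_covered:
  assumes xy: "x \<in> carrier R" "y \<in> carrier R" and rc: "(r, c) \<in> copies"
  shows "\<exists>z\<in>points. Inl (x, y) \<in> nbhd z \<and> Inr (r, c) \<in> nbhd z"
proof (cases c)
  case None
  obtain z where "z \<in> points" "nbhd z = vertical x \<union> column None"
    using vertical_covered xy(1) .
  with None xy rc show ?thesis by (auto simp: vertical_def column_def)
next
  case (Some s)
  with rc have s: "s \<in> carrier R" by (auto simp: copies_def slopes_def)
  obtain z where "z \<in> points" "nbhd z = line s (y \<ominus> s \<otimes> x) \<union> column (Some s)"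
    using line_covered[OF s] s xy by (metis m_closed minus_closed)
  with Some rc show ?thesis
    using mem_line[OF s xy] by (auto simp: column_def)
qed

lemma infinite_pair_covered:
  assumes rc: "(r, c) \<in> copies" "(r', c') \<in> copies"
  shows "\<exists>z\<in>points. Inr (r, c) \<in> nbhd z \<and> Inr (r', c') \<in> nbhd z"
  using rc
proof (induction r r' arbitrary: c c' rule: linorder_wlog)
  case (sym r r')
  then show ?case by blast
next
  case (le r r')
  consider "c = c'" | "r = r'" | "c \<noteq> c'" "r < r'" using le(1) le_neq_implies_less by blast
  then show ?case
  proof cases
    case 1
    have "c \<in> slopes" using le(2) by (simp add: copies_def)
    then obtain z where "z \<in> points" "column c \<subseteq> nbhd z" by (rule column_covered)
    with le 1 show ?thesis by (auto simp: column_def)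
  next
    case 2
    \<comment> \<open>The vertical column has an entry in every row, and \<open>nbhd\<close> of that
      entry contains the row even for \<open>r = m\<close>.\<close>
    have "(r, None) \<in> copies" using le by (auto simp: copies_def slopes_def)
    moreover have "row r \<subseteq> nbhd (Inr (r, None))"
      by (auto simp: last_copy_def)
    ultimately show ?thesis
      using le 2 by (intro bexI[of _ "Inr (r, None)"]) (auto simp: row_def points_def)
  next
    case 3
    \<comment> \<open>Column \<open>c'\<close> has an entry in row \<open>r'\<close>, so its entry
      in the lower-numbered row \<open>r\<close> exists and is not the last copy. Its neighbourhood
      is therefore row \<open>r\<close> together with column \<open>c'\<close>, which contains both
      copies.\<close>
    then have "(r, c') \<in> copies" "r \<noteq> last_copy c'"
      using le by (auto simp: copies_def last_copy_def)
    then show ?thesis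
      using le by (intro bexI[of _ "Inr (r, c')"]) (auto simp: row_def column_def points_def)
  qed
qed

lemma pair_covered:
  assumes "u \<in> points" "v \<in> points"
  shows "\<exists>z\<in>points. u \<in> nbhd z \<and> v \<in> nbhd z"
proof -
  have affine: "x \<in> carrier R \<and> y \<in> carrier R" if "Inl (x, y) \<in> points" for x y
    using that by (auto simp: points_def)
  have infinite: "(r, c) \<in> copies" if "Inr (r, c) \<in> points" for r c
    using that by (auto simp: points_def)
  show ?thesis
  proof (cases u rule: nbhd.cases)
    case u: (1 x y)
    show ?thesis
    proof (cases v rule: nbhd.cases)
      case v: (1 x' y')
      show ?thesis
        using assms affine_pair_covered[of x y x' y'] affine[of x y] affine[of x' y']
        unfolding u v by blast
    next
      case v: (2 r c)
      show ?thesis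
        using assms affine_infinite_pair_covered[of x y r c] affine[of x y] infinite[of r c]
        unfolding u v by blast
    qed
  next
    case u: (2 r c)
    show ?thesis
    proof (cases v rule: nbhd.cases)
      case v: (1 x y)
      show ?thesis
        using assms affine_infinite_pair_covered[of x y r c] affine[of x y] infinite[of r c]
        unfolding u v by blast
    next
      case v: (2 r' c')
      show ?thesis
        using assms infinite_pair_covered[of r c r' c'] infinite[of r c] infinite[of r' c']
        unfolding u v by blast
    qed
  qed
qed

lemma mediation_number_card_points: "mediation_number (card points) \<le> card (carrier R) + m"
proof (rule mediation_number_le_of_cover[where N = nbhd])
  show "points \<noteq> {}" by (auto simp: points_def)
qed (use finite_points mem_nbhd nbhd_closed card_nbhd pair_covered in blast)+

end

theorem theorem5p1:
  fixes n q :: nat and m t :: int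
  assumes "primepow q"
    and "1 \<le> m" and "m \<le> int q + 1"
    and "0 \<le> t" and "t \<le> int q"
    and "int n = int q ^ 2 + int q + 1 + m * (int q + 1) - t"
  shows "int (mediation_number n) \<le> int q + m"
proof -
  obtain F :: "((int list \<times> nat) multiset \<Rightarrow> int) ring" where F: "field F" "order F = q"
    using exists_field_of_primepow_order[OF assms(1)] by blast
  have card_F: "card (carrier F) = q" using F(2) by (simp add: order_def)
  \<comment> \<open>The \<open>t\<close> slopes that lose a copy are chosen among the
    \<open>q\<close> finite ones, which is possible by \<open>t \<le> q\<close>.\<close>
  obtain T where T: "T \<subseteq> carrier F" "card T = nat t"
    using assms(4,5) obtain_subset_with_card_n[of "nat t" "carrier F"] card_F by (metis nat_le_iff)
  interpret F: field F by (rule F(1))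
  interpret blown_up_plane F "nat m" T
    by unfold_locales
       (use assms primepow_gt_0_nat[OF assms(1)] T card_F card_ge_0_finite in auto)
  have "int (card points + nat t) = int (q ^ 2 + Suc (nat m) * Suc q)"
    using card_points by (simp only: T card_F)
  then have "card points = n"
    using assms by (simp add: algebra_simps)
  then show ?thesis
    using mediation_number_card_points assms(2) by (simp add: card_F)
qed

end
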